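(* Let $n \ge 3$ be an integer with $n \ne 6$. Then there exist Latin squares $A$ and $B$ of order $n$ such that the two Choi type Latin squares $A \otimes_S A$ and $B \otimes_S B$ of order $n^2$ are orthogonal.
   Context: A Latin square of order $n$ is an $n\times n$ array with entries in $\{1,\dots,n\}$ in which each symbol occurs exactly once in each row and each column. Two Latin squares $(a_{ij})$, $(b_{ij})$ of the same order $n$ are orthogonal if the $n^2$ ordered pairs $(a_{ij},b_{ij})$ are all distinct, i.e. exhaust $\{1,\dots,n\}^2$. For a Latin square $A=(a_{ij})$ of order $n$ and a Latin square $B$ of order $m$, the substituted Kronecker product $A\otimes_S B$ is the $mn\times mn$ block matrix whose $(i,j)$ block (for $1\le i,j\le n$) is the $m\times m$ matrix $m(a_{ij}-1)N_m + B$, where $N_m$ is the $m\times m$ all-ones matrix. If $A$ is a Latin square of order $n$, then $A\otimes_S A$ is called a Choi type Latin square of order $n^2$. *)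

theory Defs
  imports "Jordan_Normal_Form.Matrix"
begin

text \<open>
  Rows and columns are indexed from 0, as usual for the type \<^typ>\<open>'a mat\<close>; the symbols of a
  Latin square of order \<open>n\<close> are \<open>1, \<dots>, n\<close>.
\<close>

definition latin_square :: "nat \<Rightarrow> nat mat \<Rightarrow> bool" where
  "latin_square n A \<longleftrightarrow>
     A \<in> carrier_mat n n \<and>
     (\<forall>i<n. \<forall>j<n. A $$ (i, j) \<in> {1..n}) \<and>
     (\<forall>i<n. \<forall>s\<in>{1..n}. \<exists>!j. j < n \<and> A $$ (i, j) = s) \<and>
     (\<forall>j<n. \<forall>s\<in>{1..n}. \<exists>!i. i < n \<and> A $$ (i, j) = s)"

definition orthogonal_latin_squares :: "nat \<Rightarrow> nat mat \<Rightarrow> nat mat \<Rightarrow> bool" where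
  "orthogonal_latin_squares n A B \<longleftrightarrow>
     latin_square n A \<and> latin_square n B \<and>
     inj_on (\<lambda>(i, j). (A $$ (i, j), B $$ (i, j))) ({..<n} \<times> {..<n})"

definition all_ones_mat :: "nat \<Rightarrow> nat mat" where
  "all_ones_mat m = mat m m (\<lambda>_. 1)"

text \<open>
  With \<open>m\<close> the order of \<open>B\<close>, the entry at \<open>(r, c)\<close> lies in block \<open>(r div m, c div m)\<close>, at
  position \<open>(r mod m, c mod m)\<close> within it. The subtraction on \<^typ>\<open>nat\<close> does not truncate when
  \<open>A\<close> is a Latin square, since its entries are then at least 1.
\<close>

definition subst_kronecker :: "nat mat \<Rightarrow> nat mat \<Rightarrow> nat mat" (infixl "\<otimes>\<^sub>S" 70) where
  "A \<otimes>\<^sub>S B =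
     (let n = dim_row A; m = dim_row B;
          block = (\<lambda>i j. (m * (A $$ (i, j) - 1)) \<cdot>\<^sub>m all_ones_mat m + B)
      in mat (m * n) (m * n) (\<lambda>(r, c). block (r div m) (c div m) $$ (r mod m, c mod m)))"

definition choi_type :: "nat mat \<Rightarrow> nat mat" where
  "choi_type A = A \<otimes>\<^sub>S A"

end

theory Submission
  imports Defs
begin

text \<open>
  Splitting a symbol of a Choi type square into its block part and its part within the block shows
  that \<open>choi_type A\<close> and \<open>choi_type B\<close> are orthogonal as soon as \<open>A\<close> and \<open>B\<close> are. So the content is
  the theorem of Bose, Shrikhande and Parker that orthogonal Latin squares of order \<open>n\<close> exist for
  all \<open>n \<ge> 3\<close> with \<open>n \<noteq> 6\<close>, which amounts to orthogonal arrays with 4 columns.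

  Linear forms modulo \<open>n\<close> settle odd \<open>n\<close>, and products with the orders 4 and 8 then settle
  \<open>4 dvd n\<close>. For \<open>n mod 4 = 2\<close> and \<open>n \<ge> 18\<close>, one can write \<open>n = 3 * t + u\<close> with \<open>u \<le> t\<close> odd and
  an array with 5 columns of order \<open>t\<close> available (\<open>t = 9\<close> or \<open>t\<close> coprime to 6), and Wilson's
  construction applies. The orders 10 and 14 come from quasi-difference matrices.
\<close>

section \<open>Orthogonal arrays and counting\<close>

text \<open>Strength 2 and index 1. Entries of a row from position \<open>k\<close> on are
  unconstrained; \<open>S\<close> is an arbitrary set so that pairs can serve as symbols.\<close>

definition orthogonal_array :: "nat \<Rightarrow> 'a set \<Rightarrow> (nat \<Rightarrow> 'a) set \<Rightarrow> bool" where
  "orthogonal_array k S Q \<longleftrightarrow> (\<forall>i<k. \<forall>j<k. i \<noteq> j \<longrightarrow> bij_betw (\<lambda>q. (q i, q j)) Q (S \<times> S))"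

definition has_oa :: "nat \<Rightarrow> nat \<Rightarrow> bool" where
  "has_oa k n \<longleftrightarrow> (\<exists>Q. orthogonal_array k {..<n} Q)"

lemma oa_bij: "orthogonal_array k S Q \<Longrightarrow> i < k \<Longrightarrow> j < k \<Longrightarrow> i \<noteq> j \<Longrightarrow> bij_betw (\<lambda>q. (q i, q j)) Q (S \<times> S)"
  by (simp add: orthogonal_array_def)

lemma oa_obtain:
  assumes "orthogonal_array k S Q" "i < k" "j < k" "i \<noteq> j" "x \<in> S" "y \<in> S"
  obtains q where "q \<in> Q" "q i = x" "q j = y"
proof -
  have "(x, y) \<in> (\<lambda>q. (q i, q j)) ` Q"
    using oa_bij[OF assms(1-4)] assms(5,6) by (simp add: bij_betw_def)
  then show thesis using that by auto
qed

lemma oa_eqI: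
  assumes "orthogonal_array k S Q" "i < k" "j < k" "i \<noteq> j" "q \<in> Q" "r \<in> Q" "q i = r i" "q j = r j"
  shows "q = r"
  using oa_bij[OF assms(1-4)] assms(5-) by (auto simp: bij_betw_def inj_on_def)

lemma oa_mem:
  assumes "orthogonal_array k S Q" "k \<ge> 2" "q \<in> Q" "i < k"
  shows "q i \<in> S"
proof -
  obtain j where "j < k" "j \<noteq> i"
    using assms(2) by (metis less_le_trans one_less_numeral_iff pos2 semiring_norm(76) zero_neq_one)
  then show ?thesis
    using bij_betwE[OF oa_bij[OF assms(1,4)]] assms(3) by fastforce
qed

lemma oa_card:
  assumes "orthogonal_array k S Q" "k \<ge> 2"
  shows "card Q = card S ^ 2"
  using bij_betw_same_card[OF oa_bij[OF assms(1), of 0 1]] assms(2)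
  by (simp add: card_cartesian_product power2_eq_square)

lemma oa_finite:
  assumes "orthogonal_array k S Q" "k \<ge> 2" "finite S"
  shows "finite Q"
  using bij_betw_finite[OF oa_bij[OF assms(1), of 0 1]] assms(2,3) by simp

text \<open>A surjection from at most \<open>card S ^ 2\<close> rows onto
  \<open>S \<times> S\<close> is injective, so a construction only needs a coverage check and a row
  count.\<close>

lemma oa_coverI:
  assumes "finite S" "finite Q" "card Q \<le> card S ^ 2"
    and cover: "\<And>i j x y. i < k \<Longrightarrow> j < k \<Longrightarrow> i \<noteq> j \<Longrightarrow> x \<in> S \<Longrightarrow> y \<in> S \<Longrightarrow> \<exists>q\<in>Q. q i = x \<and> q j = y"
  shows "orthogonal_array k S Q"
  unfolding orthogonal_array_def
proof (intro allI impI)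
  fix i j assume ij: "i < k" "j < k" "i \<noteq> j"
  let ?f = "\<lambda>q. (q i, q j)"
  have sub: "S \<times> S \<subseteq> ?f ` Q"
    using cover[OF ij] by (force simp: image_iff)
  have "card (?f ` Q) \<le> card Q" by (rule card_image_le[OF assms(2)])
  also have "\<dots> \<le> card (S \<times> S)" using assms(3) by (simp add: card_cartesian_product power2_eq_square)
  finally have eq: "S \<times> S = ?f ` Q"
    by (intro card_seteq sub) (simp_all add: assms(2))
  moreover have "card (?f ` Q) = card Q"
    using \<open>card (?f ` Q) \<le> card Q\<close> \<open>card Q \<le> card (S \<times> S)\<close> eq by simp
  then have "inj_on ?f Q" by (intro eq_card_imp_inj_on assms(2))
  ultimately show "bij_betw ?f Q (S \<times> S)" by (simp add: bij_betw_def)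
qed

lemma oa_relabel:
  assumes "orthogonal_array k S Q" "bij_betw h S T"
  shows "orthogonal_array k T ((\<lambda>q. h \<circ> q) ` Q)"
  unfolding orthogonal_array_def
proof (intro allI impI)
  fix i j assume ij: "i < k" "j < k" "i \<noteq> j"
  let ?f = "\<lambda>q. (q i, q j)"
  have b: "bij_betw (map_prod h h \<circ> ?f) Q (T \<times> T)"
    by (rule bij_betw_trans[OF oa_bij[OF assms(1) ij]])
      (use assms(2) in \<open>auto simp: bij_betw_def inj_on_def map_prod_def image_iff\<close>)
  have comp: "map_prod h h \<circ> ?f = ?f \<circ> (\<lambda>q. h \<circ> q)" by auto
  have inj: "inj_on (\<lambda>q. h \<circ> q) Q"
    using b unfolding comp bij_betw_def by (blast intro: inj_on_imageI2)
  then have "bij_betw (\<lambda>q. h \<circ> q) Q ((\<lambda>q. h \<circ> q) ` Q)" by (simp add: bij_betw_def)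
  from bij_betw_comp_iff[OF this, of ?f "T \<times> T"] b
  show "bij_betw ?f ((\<lambda>q. h \<circ> q) ` Q) (T \<times> T)" unfolding comp by simp
qed

lemma has_oaI:
  assumes "orthogonal_array k S Q" "finite S" "card S = n"
  shows "has_oa k n"
proof -
  obtain h where "bij_betw h S {..<n}"
    using finite_same_card_bij[of S "{..<n}"] assms(2,3) by auto
  from oa_relabel[OF assms(1) this] show ?thesis unfolding has_oa_def by blast
qed

section \<open>Products and linear forms\<close>

text \<open>MacNeish's product: the two components of a symbol are prescribed independently, one in
  each array.\<close>

lemma has_oa_mult:
  assumes "has_oa k m" "has_oa k n" "k \<ge> 2"
  shows "has_oa k (m * n)"
proof -
  obtain Q R where Q: "orthogonal_array k {..<m} Q" and R: "orthogonal_array k {..<n} R"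
    using assms by (auto simp: has_oa_def)
  let ?P = "(\<lambda>(q, r) i. (q i, r i)) ` (Q \<times> R)"
  have fin: "finite Q" "finite R" using oa_finite[OF Q] oa_finite[OF R] assms(3) by auto
  have "orthogonal_array k ({..<m} \<times> {..<n}) ?P"
  proof (rule oa_coverI)
    have "card ?P \<le> card (Q \<times> R)" by (rule card_image_le) (simp add: fin)
    also have "\<dots> = (m * n)\<^sup>2"
      using oa_card[OF Q] oa_card[OF R] assms(3) by (simp add: card_cartesian_product power_mult_distrib)
    finally show "card ?P \<le> card ({..<m} \<times> {..<n})^2" by (simp add: card_cartesian_product)
  next
    fix i j x y assume ij: "i < k" "j < k" "i \<noteq> j"
      and "x \<in> {..<m} \<times> {..<n}" "y \<in> {..<m} \<times> {..<n}"
    then obtain x1 x2 y1 y2 where xy: "x = (x1, x2)" "y = (y1, y2)" and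
      mem: "x1 \<in> {..<m}" "y1 \<in> {..<m}" "x2 \<in> {..<n}" "y2 \<in> {..<n}" by auto
    obtain q where "q \<in> Q" "q i = x1" "q j = y1" by (rule oa_obtain[OF Q ij mem(1,2)])
    moreover obtain r where "r \<in> R" "r i = x2" "r j = y2" by (rule oa_obtain[OF R ij mem(3,4)])
    ultimately show "\<exists>p\<in>?P. p i = x \<and> p j = y"
      by (intro bexI[of _ "\<lambda>i. (q i, r i)"]) (auto simp: xy)
  qed (auto simp: fin)
  then show ?thesis by (rule has_oaI) (auto simp: card_cartesian_product)
qed

text \<open>Column \<open>i\<close> is the form \<open>a i * x + b i * y\<close> at the points
  \<open>(x, y)\<close> modulo \<open>n\<close>; two columns determine the point because their
  determinant is a unit.\<close>

lemma has_oa_linear: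
  fixes a b :: "nat \<Rightarrow> int"
  assumes "n > 0"
    and det: "\<And>i j. i < j \<Longrightarrow> j < k \<Longrightarrow> coprime (a i * b j - a j * b i) (int n)"
  shows "has_oa k n"
proof -
  let ?S = "{0..<int n}"
  let ?f = "\<lambda>(x, y) i. (a i * x + b i * y) mod int n"
  have inj: "inj_on (\<lambda>p. (?f p i, ?f p j)) (?S \<times> ?S)" if ij: "i < k" "j < k" "i \<noteq> j" for i j
  proof (rule inj_onI, clarify)
    fix x y x' y'
    assume mem: "x \<in> ?S" "y \<in> ?S" "x' \<in> ?S" "y' \<in> ?S"
    assume "(a i * x + b i * y) mod int n = (a i * x' + b i * y') mod int n"
      and "(a j * x + b j * y) mod int n = (a j * x' + b j * y') mod int n"
    then obtain u v where
      u: "(a i * x + b i * y) - (a i * x' + b i * y') = int n * u" and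
      v: "(a j * x + b j * y) - (a j * x' + b j * y') = int n * v"
      by (auto simp: mod_eq_dvd_iff dvd_def)
    let ?d = "a i * b j - a j * b i"
    have cop: "coprime ?d (int n)"
    proof (cases "i < j")
      case False
      then have "coprime (a j * b i - a i * b j) (int n)" using det[of j i] ij by simp
      then show ?thesis by (metis coprime_minus_left_iff minus_diff_eq)
    qed (use det ij in simp)
    \<comment> \<open>Cramer's rule: \<open>y\<close> is eliminated here, and \<open>x\<close>
      below.\<close>
    have "?d * (x - x') = int n * (b j * u - b i * v)"
      using arg_cong[OF u, of "\<lambda>z. b j * z"] arg_cong[OF v, of "\<lambda>z. b i * z"]
      by (simp add: algebra_simps)
    then have "int n dvd x - x'"
      using cop by (metis coprime_commute coprime_dvd_mult_right_iff dvd_triv_left)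
    moreover have "?d * (y - y') = int n * (a i * v - a j * u)"
      using arg_cong[OF u, of "\<lambda>z. a j * z"] arg_cong[OF v, of "\<lambda>z. a i * z"]
      by (simp add: algebra_simps)
    then have "int n dvd y - y'"
      using cop by (metis coprime_commute coprime_dvd_mult_right_iff dvd_triv_left)
    ultimately show "x = x' \<and> y = y'"
      using mem by (metis atLeastLessThan_iff mod_eq_dvd_iff mod_pos_pos_trivial)
  qed
  have "orthogonal_array k ?S (?f ` (?S \<times> ?S))"
  proof (rule oa_coverI)
    show "card (?f ` (?S \<times> ?S)) \<le> card ?S ^ 2"
      using card_image_le[of "?S \<times> ?S" ?f] by (simp add: card_cartesian_product power2_eq_square)
  next
    fix i j x y assume ij: "i < k" "j < k" "i \<noteq> j" and xy: "x \<in> ?S" "y \<in> ?S"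
    have "(\<lambda>p. (?f p i, ?f p j)) ` (?S \<times> ?S) = ?S \<times> ?S"
      by (rule endo_inj_surj[OF _ _ inj[OF ij]]) (use assms(1) in auto)
    then have "(x, y) \<in> (\<lambda>p. (?f p i, ?f p j)) ` (?S \<times> ?S)" using xy by simp
    then show "\<exists>q\<in>?f ` (?S \<times> ?S). q i = x \<and> q j = y" by auto
  qed auto
  then show ?thesis by (rule has_oaI) auto
qed

text \<open>The forms \<open>x\<close>, \<open>y\<close>, \<open>x + y\<close>, \<open>x - y\<close>
  have pairwise determinants 1, -1 or -2.\<close>

lemma has_oa_4_odd:
  assumes "odd n"
  shows "has_oa 4 n"
proof (rule has_oa_linear[where a = "\<lambda>i. [1, 0, 1, 1] ! i" and b = "\<lambda>i. [0, 1, 1, -1] ! i"])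
  have c: "coprime 2 (int n)" "coprime (-2) (int n)" using assms by simp_all
  show "coprime ([1, 0, 1, 1] ! i * [0, 1, 1, -1] ! j - [1, 0, 1, 1] ! j * [0, 1, 1, -1] ! i) (int n)"
    if "i < j" "j < 4" for i j :: nat
  proof -
    have "i \<in> {0,1,2}" "j \<in> {1,2,3}" using that by auto
    then show ?thesis using that c by (auto simp: numeral_eq_Suc)
  qed
qed (use assms in \<open>auto intro: Nat.gr0I\<close>)

text \<open>The forms \<open>x + i * y\<close> for \<open>i < 5\<close> have determinants
  \<open>j - i\<close> from 1 to 4, with no prime factors besides 2 and 3.\<close>

lemma has_oa_5_coprime_6:
  assumes "coprime n 6"
  shows "has_oa 5 n"
proof (rule has_oa_linear[where a = "\<lambda>_. 1" and b = int])
  show "n > 0" using assms by (auto intro: Nat.gr0I)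
  have c2: "coprime (2::int) (int n)" and c3: "coprime (3::int) (int n)"
    using assms coprime_divisors[of n n 2 6] coprime_divisors[of n n 3 6]
    by (simp_all add: coprime_commute flip: coprime_int_iff)
  show "coprime (1 * int j - 1 * int i) (int n)" if "i < j" "j < 5" for i j
  proof -
    have "int j - int i \<in> {1, 2, 3, 2 * 2}" using that by auto
    then show ?thesis using c2 c3 coprime_mult_left_iff[of "2::int" 2 "int n"] by (auto simp del: mult_numeral_left)
  qed
qed

section \<open>Quasi-difference matrices and small orders\<close>

text \<open>
  The columns of a quasi-difference matrix over \<open>\<int>/n\<close> are the members of \<open>C\<close>. The symbols
  \<open>n, \<dots>, n + u - 1\<close> play the role of the empty entry and are fixed points under translation.
  The last disjunction says \<open>(c ! i + d) mod n = c ! j\<close> without \<open>mod\<close>, which \<open>code_simp\<close>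
  evaluates too slowly on \<^typ>\<open>nat\<close>.
\<close>

definition quasi_difference :: "nat \<Rightarrow> nat \<Rightarrow> nat \<Rightarrow> nat list list \<Rightarrow> bool" where
  "quasi_difference k n u C \<longleftrightarrow> length C \<le> n + 2 * u \<and>
     (\<forall>i\<in>set [0..<k]. \<forall>j\<in>set [0..<k]. i \<noteq> j \<longrightarrow>
        (\<forall>d\<in>set [0..<n]. \<exists>c\<in>set C. c ! i < n \<and> c ! j < n \<and>
           (c ! j = c ! i + d \<or> c ! j + n = c ! i + d)) \<and>
        (\<forall>x\<in>set [n..<n+u]. \<exists>c\<in>set C. c ! i = x \<and> c ! j < n))"

text \<open>All translates of the columns in \<open>C\<close> cover the pairs with a symbol below
  \<open>n\<close>, and \<open>E\<close> covers the rest. The count is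
  \<open>(n + 2 * u) * n + u * u = (n + u) * (n + u)\<close>.\<close>

lemma oa_quasi_difference:
  assumes C: "quasi_difference k n u C" and "k \<ge> 2" "n > 0"
    and E: "orthogonal_array k {n..<n+u} E"
  obtains Q where "orthogonal_array k {..<n+u} Q" "E \<subseteq> Q"
proof -
  let ?f = "\<lambda>(c, g) i. if c ! i < n then (c ! i + g) mod n else c ! i"
  let ?Q = "?f ` (set C \<times> {..<n}) \<union> E"
  have len: "length C \<le> n + 2 * u" using C by (simp add: quasi_difference_def)
  have finE: "finite E" using oa_finite[OF E] assms(2) by simp
  have shift: "(a + (x + n - a)) mod n = x" if "a < n" "x < n" for a x
    using that by simp
  have "orthogonal_array k {..<n+u} ?Q"
  proof (rule oa_coverI)
    have "card ?Q \<le> card (?f ` (set C \<times> {..<n})) + card E" by (rule card_Un_le)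
    also have "card (?f ` (set C \<times> {..<n})) \<le> card (set C \<times> {..<n})" by (rule card_image_le) simp
    also have "\<dots> \<le> (n + 2 * u) * n"
      using card_length[of C] len by (simp add: card_cartesian_product)
    also have "card E = u\<^sup>2" using oa_card[OF E] assms(2) by simp
    finally show "card ?Q \<le> card {..<n+u} ^ 2" by (simp add: power2_eq_square algebra_simps)
  next
    fix i j x y assume ij: "i < k" "j < k" "i \<noteq> j" and "x \<in> {..<n+u}" "y \<in> {..<n+u}"
    then have xy: "x < n + u" "y < n + u" by auto
    have diff: "\<exists>c\<in>set C. c ! i < n \<and> c ! j < n \<and> (c ! i + d) mod n = c ! j" if "d < n" for d
    proof -
      have "\<exists>c\<in>set C. c ! i < n \<and> c ! j < n \<and> (c ! j = c ! i + d \<or> c ! j + n = c ! i + d)"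
        using C ij that by (simp add: quasi_difference_def)
      then show ?thesis by (metis mod_add_self2 mod_less)
    qed
    have inf: "\<exists>c\<in>set C. c ! i' = z \<and> c ! j' < n"
      if "(i', j') \<in> {(i, j), (j, i)}" "n \<le> z" "z < n + u" for i' j' z
      using C ij that unfolding quasi_difference_def by auto
    have row: "\<exists>q\<in>?Q. q i = x \<and> q j = y"
      if "c \<in> set C" "?f (c, g mod n) i = x" "?f (c, g mod n) j = y" for c g
      using that \<open>n > 0\<close> by (intro bexI[of _ "?f (c, g mod n)"] conjI UnI1 imageI) auto
    consider "x < n" "y < n" | "x \<ge> n" "y < n" | "x < n" "y \<ge> n" | "x \<ge> n" "y \<ge> n" by linarith
    then show "\<exists>q\<in>?Q. q i = x \<and> q j = y"
    proof cases
      case 1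
      \<comment> \<open>The difference \<open>y - x\<close> selects \<open>c\<close>; the
        translation taking \<open>c ! i\<close> to \<open>x\<close> then takes \<open>c ! j\<close>
        to \<open>y\<close>. Adding \<open>n\<close> first keeps subtraction on \<open>nat\<close>
        from truncating.\<close>
      obtain c where c: "c \<in> set C" "c ! i < n" "c ! j < n" "(c ! i + (y + n - x) mod n) mod n = c ! j"
        using diff[of "(y + n - x) mod n"] \<open>n > 0\<close> by auto
      have "(c ! j + (x + n - c ! i)) mod n = (c ! i + (y + n - x) + (x + n - c ! i)) mod n"
        unfolding c(4)[symmetric] by (simp add: mod_simps)
      also have "c ! i + (y + n - x) + (x + n - c ! i) = y + n + n" using 1 c(2) by simp
      finally have "(c ! j + (x + n - c ! i)) mod n = y" using 1 by simp
      then show ?thesis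
        using row[OF c(1), of "x + n - c ! i"] c(2,3) shift[OF c(2) 1(1)] by (simp add: mod_simps)
    next
      case 2
      then obtain c where c: "c \<in> set C" "c ! i = x" "c ! j < n" using inf[of i j x] xy by auto
      then show ?thesis
        using row[OF c(1), of "y + n - c ! j"] shift[OF c(3) 2(2)] 2 by (simp add: mod_simps)
    next
      case 3
      then obtain c where c: "c \<in> set C" "c ! j = y" "c ! i < n" using inf[of j i y] xy by auto
      then show ?thesis
        using row[OF c(1), of "x + n - c ! i"] shift[OF c(3) 3(1)] 3 by (simp add: mod_simps)
    next
      case 4
      then obtain q where "q \<in> E" "q i = x" "q j = y"
        using oa_obtain[OF E ij, of x y] xy by auto
      then show ?thesis by blast
    qed
  qed (auto simp: finE)
  then show ?thesis by (rule that) blast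
qed

lemma oa_singleton: "orthogonal_array k {x} {\<lambda>_. x}"
  by (auto simp: orthogonal_array_def bij_betw_def)

text \<open>The constant row is the array on the single fixed symbol 3; Wilson's construction
  removes it.\<close>

lemma oa_4_4:
  obtains Q where "orthogonal_array 4 {..<4::nat} Q" "(\<lambda>_. 3) \<in> Q"
proof -
  have C: "quasi_difference 4 3 1 [[3,0,0,0], [0,3,0,1], [0,1,2,3], [0,0,3,2], [0,2,1,0]]"
    by code_simp
  have "{3..<3 + (1::nat)} = {3}" by auto
  then have "orthogonal_array 4 {3..<3+1} {\<lambda>_. 3::nat}" by (simp add: oa_singleton)
  from oa_quasi_difference[OF C _ _ this] show ?thesis using that by auto
qed

lemma has_oa_quasi_difference:
  assumes "quasi_difference k n u C" "k \<ge> 2" "n > 0" "has_oa k u"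
  shows "has_oa k (n + u)"
proof -
  obtain E where E: "orthogonal_array k {..<u} E" using assms(4) by (auto simp: has_oa_def)
  have "bij_betw ((+) n) {..<u} {n..<n+u}"
    by (simp add: bij_betw_def lessThan_atLeast0 add.commute)
  from oa_quasi_difference[OF assms(1-3) oa_relabel[OF E this]]
  show ?thesis unfolding has_oa_def by blast
qed

lemma has_oa_1: "has_oa k 1"
  by (rule has_oaI[OF oa_singleton[of k "0::nat"]]) simp_all

text \<open>
  The matrices for the orders 4, 8 and 9 consist of discrete logarithms in the field of that order
  of the linear forms \<open>x, y, x + y, w * x + y, \<dots>\<close> (\<open>w\<close> a primitive element) at the points of the
  projective line, with the last symbol standing for 0.
\<close>

lemma has_oa_4_8: "has_oa 4 8"
proof -
  have "quasi_difference 4 7 1 [[7,0,0,0], [0,7,0,1], [0,2,6,4], [0,1,3,7], [0,4,5,2], [0,0,7,3],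
      [0,6,2,5], [0,3,1,0], [0,5,4,6]]"
    by code_simp
  from has_oa_quasi_difference[OF this _ _ has_oa_1] show ?thesis by simp
qed

lemma has_oa_5_9: "has_oa 5 9"
proof -
  have "quasi_difference 5 8 1 [[8,0,0,0,0], [0,8,0,1,2], [0,1,2,5,3], [0,5,3,8,0], [0,0,4,2,7],
      [0,2,7,3,6], [0,3,6,0,4], [0,4,8,7,1], [0,7,1,6,5], [0,6,5,4,8]]"
    by code_simp
  from has_oa_quasi_difference[OF this _ _ has_oa_1] show ?thesis by simp
qed

text \<open>Closing a matrix under cyclic shifts makes the condition on entries \<open>i\<close> and
  \<open>j\<close> depend only on \<open>j - i\<close> modulo the column length.\<close>

definition rotations :: "'a list \<Rightarrow> 'a list list" where
  "rotations xs = map (\<lambda>r. rotate r xs) [0..<length xs]"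

text \<open>Modulo 7, cyclically adjacent entries of the base columns differ by 1, 5; 2, 3; 6, 4 and
  entries two apart by 6, 1; 5, 2; 3, 4. The zero column supplies the difference 0.\<close>

lemma has_oa_4_10: "has_oa 4 10"
proof -
  have "quasi_difference 4 7 3
      ([0,0,0,0] # concat (map rotations [[7,0,1,6], [8,0,2,5], [9,0,6,3]]))"
    by code_simp
  from has_oa_quasi_difference[OF this _ _ has_oa_4_odd] show ?thesis by simp
qed

text \<open>Modulo 11, the adjacent differences are 3, 7; 5, 4; 1, 2 and, from the column without an
  empty entry, 6, 9, 8, 10.\<close>

lemma has_oa_4_14: "has_oa 4 14"
proof -
  have "quasi_difference 4 11 3
      ([0,0,0,0] # concat (map rotations [[11,0,3,10], [12,0,5,9], [13,0,1,3], [0,6,4,1]]))"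
    by code_simp
  from has_oa_quasi_difference[OF this _ _ has_oa_4_odd] show ?thesis by simp
qed

section \<open>Wilson's construction\<close>

text \<open>
  The last column of \<open>R\<close> is truncated to \<open>u\<close> symbols, which become points at infinity, copied into
  every other column. Each of the other symbols is inflated \<open>m\<close> times: a row of \<open>R\<close> whose last
  entry survives is replaced by \<open>E\<close> without its constant row, with that entry in the role of \<open>m\<close>,
  and the remaining rows are replaced by \<open>D\<close>. Finally \<open>F\<close> fills the points at infinity.
\<close>

lemma has_oa_wilson:
  assumes "k \<ge> 2" "u \<le> t"
    and R: "orthogonal_array (Suc k) {..<t} R" and D: "orthogonal_array k {..<m} D"
    and E: "orthogonal_array k {..m} E" "(\<lambda>_. m) \<in> E" and F: "orthogonal_array k {..<u} F"
  shows "has_oa k (m * t + u)"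
proof -
  \<comment> \<open>The pairs \<open>(x, m)\<close> with \<open>x < u\<close> are the points at
    infinity.\<close>
  let ?S = "{..<t} \<times> {..<m} \<union> {..<u} \<times> {m}"
  define R1 where "R1 = {r\<in>R. r k < u}"
  define R2 where "R2 = {r\<in>R. \<not> r k < u}"
  define E' where "E' = E - {\<lambda>_. m}"
  let ?f1 = "\<lambda>(r, s) i. if s i = m then (r k, m) else (r i, s i)"
  let ?f2 = "\<lambda>(r, s) i. (r i, s i)"
  let ?f3 = "\<lambda>q i. (q i, m)"
  let ?Q = "?f1 ` (R1 \<times> E') \<union> ?f2 ` (R2 \<times> D) \<union> ?f3 ` F"
  have fin: "finite R" "finite D" "finite E" "finite F"
    using oa_finite[OF R] oa_finite[OF D] oa_finite[OF E(1)] oa_finite[OF F] assms(1) by auto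
  then have fin': "finite R1" "finite R2" "finite E'" by (auto simp: R1_def R2_def E'_def)
  have cardS: "card ?S = m * t + u"
    by (subst card_Un_disjoint) (auto simp: card_cartesian_product)
  have "orthogonal_array k ?S ?Q"
  proof (rule oa_coverI)
    \<comment> \<open>Columns \<open>0\<close> and \<open>k\<close> identify \<open>R\<close> with
      all pairs, so the rows with \<open>r k < u\<close> number \<open>t * u\<close>.\<close>
    have bij: "bij_betw (\<lambda>r. (r 0, r k)) R ({..<t} \<times> {..<t})"
      using oa_bij[OF R, of 0 k] assms(1) by simp
    have "(\<lambda>r. (r 0, r k)) ` R1 = {..<t} \<times> {..<u}" (is "?g ` R1 = _")
    proof
      show "(\<lambda>r. (r 0, r k)) ` R1 \<subseteq> {..<t} \<times> {..<u}"
        using bij_betwE[OF bij] by (auto simp: R1_def)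
      show "{..<t} \<times> {..<u} \<subseteq> (\<lambda>r. (r 0, r k)) ` R1"
      proof clarify
        fix a b assume "a < t" "b < u"
        then have "(a, b) \<in> (\<lambda>r. (r 0, r k)) ` R" using bij assms(2) by (simp add: bij_betw_def)
        then show "(a, b) \<in> (\<lambda>r. (r 0, r k)) ` R1" using \<open>b < u\<close> by (auto simp: R1_def)
      qed
    qed
    moreover have "inj_on (\<lambda>r. (r 0, r k)) R1"
      by (rule inj_on_subset[OF bij_betw_imp_inj_on[OF bij]]) (auto simp: R1_def)
    ultimately have "card ({..<t} \<times> {..<u}) = card R1"
      using card_image[of ?g R1] by (simp only:)
    then have cR1: "card R1 = t * u" by (simp add: card_cartesian_product)
    obtain w where w: "t = u + w" using assms(2) le_Suc_ex by blast
    have "card R = card R1 + card R2"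
    proof (subst card_Un_disjoint[symmetric])
      have "R = R1 \<union> R2" by (auto simp: R1_def R2_def)
      then show "card R = card (R1 \<union> R2)" by (rule arg_cong)
    qed (use fin' in \<open>auto simp: R1_def R2_def\<close>)
    then have cR2: "card R2 = t * w"
      using oa_card[OF R] assms(1) cR1 by (simp add: w power2_eq_square algebra_simps)
    have cE: "card E' = m * m + 2 * m"
      using oa_card[OF E(1)] assms(1) E(2) fin by (simp add: E'_def power2_eq_square)
    have "card ?Q \<le> card (?f1 ` (R1 \<times> E')) + card (?f2 ` (R2 \<times> D)) + card (?f3 ` F)"
      by (intro order_trans[OF card_Un_le] add_right_mono card_Un_le)
    also have "\<dots> \<le> card (R1 \<times> E') + card (R2 \<times> D) + card F"
      by (intro add_mono card_image_le) (simp_all add: fin fin')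
    \<comment> \<open>With \<open>t = u + w\<close>, the sum is
      \<open>t * u * (m * m + 2 * m) + t * w * m * m + u * u\<close>.\<close>
    also have "\<dots> = (m * t + u)\<^sup>2"
      using oa_card[OF D] oa_card[OF F] assms(1)
      by (simp add: card_cartesian_product cR1 cR2 cE w power2_eq_square algebra_simps)
    finally show "card ?Q \<le> card ?S ^ 2" by (simp only: cardS)
  next
    fix i j x y assume ij: "i < k" "j < k" "i \<noteq> j" and xy: "x \<in> ?S" "y \<in> ?S"
    have ij': "i < Suc k" "j < Suc k" using ij by auto
    obtain x1 a y1 b where eq: "x = (x1, a)" "y = (y1, b)" by fastforce
    \<comment> \<open>An entry other than \<open>m\<close> in \<open>s\<close> shows that
      \<open>s\<close> is not the removed constant row.\<close>
    have row: "\<exists>q\<in>?Q. q i = z \<and> q j = z'"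
      if "r \<in> R1" "s \<in> E" "s i \<noteq> m \<or> s j \<noteq> m" "?f1 (r, s) i = z" "?f1 (r, s) j = z'" for r s z z'
    proof -
      have "(r, s) \<in> R1 \<times> E'" using that by (auto simp: E'_def)
      then have "?f1 (r, s) \<in> ?Q" by blast
      then show ?thesis using that(4,5) by blast
    qed
    consider "x1 < t" "a < m" "y1 < t" "b < m" | "x1 < u" "a = m" "y1 < t" "b < m"
      | "x1 < t" "a < m" "y1 < u" "b = m" | "x1 < u" "a = m" "y1 < u" "b = m"
      using xy eq by auto
    then show "\<exists>q\<in>?Q. q i = x \<and> q j = y"
    proof cases
      case 1
      obtain r where r: "r \<in> R" "r i = x1" "r j = y1"
        using oa_obtain[OF R ij' ij(3), of x1 y1] 1 by auto
      show ?thesis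
      proof (cases "r k < u")
        case True
        obtain s where "s \<in> E" "s i = a" "s j = b" using oa_obtain[OF E(1) ij, of a b] 1 by auto
        then show ?thesis using 1 r True by (intro row[of r s]) (auto simp: eq R1_def)
      next
        case False
        obtain s where s: "s \<in> D" "s i = a" "s j = b" using oa_obtain[OF D ij, of a b] 1 by auto
        have "(r, s) \<in> R2 \<times> D" using r s False by (simp add: R2_def)
        then have "?f2 (r, s) \<in> ?Q" by blast
        moreover have "?f2 (r, s) i = x" "?f2 (r, s) j = y" using r s by (simp_all add: eq)
        ultimately show ?thesis by blast
      qed
    next
      case 2
      \<comment> \<open>The point at infinity \<open>x1\<close> is read from column \<open>k\<close>
        of \<open>R\<close>, not column \<open>i\<close>; the entry \<open>m\<close> of
        \<open>s\<close> at \<open>i\<close> copies it there.\<close>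
      obtain r where r: "r \<in> R" "r k = x1" "r j = y1"
        using oa_obtain[OF R, of k j x1 y1] 2 ij assms(2) by auto
      obtain s where "s \<in> E" "s i = a" "s j = b" using oa_obtain[OF E(1) ij, of a b] 2 by auto
      then show ?thesis using 2 r by (intro row[of r s]) (auto simp: eq R1_def)
    next
      case 3
      obtain r where r: "r \<in> R" "r i = x1" "r k = y1"
        using oa_obtain[OF R, of i k x1 y1] 3 ij assms(2) by auto
      obtain s where "s \<in> E" "s i = a" "s j = b" using oa_obtain[OF E(1) ij, of a b] 3 by auto
      then show ?thesis using 3 r by (intro row[of r s]) (auto simp: eq R1_def)
    next
      case 4
      obtain q where "q \<in> F" "q i = x1" "q j = y1" using oa_obtain[OF F ij, of x1 y1] 4 by auto
      moreover from \<open>q \<in> F\<close> have "?f3 q \<in> ?Q" by (intro UnI2 imageI)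
      ultimately show ?thesis using 4 by (intro bexI[of _ "?f3 q"]) (simp_all add: eq)
    qed
  qed (simp_all add: fin fin')
  then show ?thesis by (rule has_oaI) (simp_all only: cardS, simp)
qed

text \<open>Inflation by \<open>m = 3\<close> uses arrays of orders 3, 4 and \<open>u\<close>; the
  fifth column at order \<open>t\<close> is the truncated one.\<close>

lemma has_oa_4_three_mult_add:
  assumes "has_oa 5 t" "odd u" "u \<le> t"
  shows "has_oa 4 (3 * t + u)"
proof -
  obtain R where R: "orthogonal_array 5 {..<t} R" using assms(1) by (auto simp: has_oa_def)
  obtain D where D: "orthogonal_array 4 {..<3::nat} D" using has_oa_4_odd[of 3] by (auto simp: has_oa_def)
  obtain E where E: "orthogonal_array 4 {..<4::nat} E" "(\<lambda>_. 3) \<in> E" by (rule oa_4_4)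
  obtain F where F: "orthogonal_array 4 {..<u} F" using has_oa_4_odd[OF assms(2)] by (auto simp: has_oa_def)
  have "{..<4} = {..3::nat}" by auto
  then show ?thesis
    using has_oa_wilson[of 4 u t R 3 D E F] R D E F assms(3) by simp
qed

section \<open>Covering all orders\<close>

lemma has_oa_4_2_mod_4:
  assumes "n mod 4 = 2" "n \<ge> 10"
  shows "has_oa 4 n"
proof -
  have oa7: "has_oa 5 7" and oa5: "has_oa 5 5"
    by (rule has_oa_5_coprime_6, simp add: coprime_iff_gcd_eq_1 gcd_non_0_nat)+
  have "n = 10 \<or> n = 14 \<or> n = 18 \<or> n = 22 \<or> n = 26 \<or> n = 30 \<or> n = 34 \<or> n \<ge> 38"
    using assms by presburger
  then consider "n = 10" | "n = 14" | "n = 18" | "n = 22" | "n = 26" | "n = 30" | "n = 34" | "n \<ge> 38"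
    by blast
  then show ?thesis
  proof cases
    case 1 then show ?thesis using has_oa_4_10 by simp
  next
    case 2 then show ?thesis using has_oa_4_14 by simp
  next
    case 3 then show ?thesis using has_oa_4_three_mult_add[OF oa5, of 3] by simp
  next
    case 4 then show ?thesis using has_oa_4_three_mult_add[OF oa7, of 1] by simp
  next
    case 5 then show ?thesis using has_oa_4_three_mult_add[OF oa7, of 5] by simp
  next
    case 6 then show ?thesis using has_oa_4_three_mult_add[OF has_oa_5_9, of 3] by simp
  next
    case 7 then show ?thesis using has_oa_4_three_mult_add[OF has_oa_5_9, of 7] by simp
  next
    case 8
    obtain q where q: "n = 4 * q + 2" using assms(1) by (metis mult_div_mod_eq)
    consider "q = 9" | "q = 10" | "q \<ge> 11" using 8 q by linarith
    \<comment> \<open>The bounds say that \<open>u = n - 3 * t\<close> lies between 0 and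
      \<open>t\<close>.\<close>
    then obtain t where t: "t mod 6 = 1 \<or> t mod 6 = 5" "3 * t \<le> n" "n \<le> 4 * t"
    proof cases
      case 1 then show ?thesis using that[of 11] q by simp
    next
      case 2 then show ?thesis using that[of 11] q by simp
    next
      case 3
      \<comment> \<open>Four consecutive integers include one coprime to 6. For
        \<open>t = q + 1 + e\<close>, \<open>4 * t \<ge> 4 * q + 4\<close> and
        \<open>3 * t \<le> 3 * q + 12\<close>, which is at most \<open>n\<close> as
        \<open>q \<ge> 11\<close>.\<close>
      have "\<exists>e\<le>3. (q + 1 + e) mod 6 = 1 \<or> (q + 1 + e) mod 6 = 5" by presburger
      then obtain e where "e \<le> 3" "(q + 1 + e) mod 6 = 1 \<or> (q + 1 + e) mod 6 = 5" by blast
      then show ?thesis using that[of "q + 1 + e"] 3 q by simp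
    qed
    have "odd t" using t(1) by presburger
    then have "n = 3 * t + (n - 3 * t)" "odd (n - 3 * t)" "n - 3 * t \<le> t"
      using t q by auto
    then obtain t u where tu: "n = 3 * t + u" "odd u" "u \<le> t" "t mod 6 = 1 \<or> t mod 6 = 5"
      using t(1) by blast
    have "coprime t 6" using tu(4) by (auto simp: coprime_iff_gcd_eq_1 gcd_non_0_nat)
    from has_oa_4_three_mult_add[OF has_oa_5_coprime_6[OF this] tu(2,3)] tu(1)
    show ?thesis by simp
  qed
qed

lemma has_oa_4_4: "has_oa 4 4"
  by (rule oa_4_4) (auto simp: has_oa_def)

lemma has_oa_4:
  assumes "n \<ge> 3" "n \<noteq> 6"
  shows "has_oa 4 n"
  using assms
proof (induction n rule: less_induct)
  case (less n)
  have "odd n \<or> n mod 4 = 2 \<or> n mod 4 = 0" by presburger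
  then consider "odd n" | "n mod 4 = 2" | "n mod 4 = 0" by metis
  then show ?case
  proof cases
    case 1 then show ?thesis by (rule has_oa_4_odd)
  next
    case 2 then show ?thesis using less.prems by (intro has_oa_4_2_mod_4) presburger+
  next
    case 3
    then obtain m where m: "n = 4 * m" by (metis mod_0_imp_dvd dvdE)
    \<comment> \<open>The factor 4 is split off except where \<open>m\<close> is below 3 or equals
      6; order 24 is instead 8 times 3.\<close>
    consider "m = 1" | "m = 2" | "m = 6" | "m \<ge> 3" "m \<noteq> 6" using less.prems m by linarith
    then show ?thesis
    proof cases
      case 1 then show ?thesis using has_oa_4_4 m by simp
    next
      case 2 then show ?thesis using has_oa_4_8 m by simp
    next
      case 3 then show ?thesis using has_oa_mult[OF has_oa_4_8 has_oa_4_odd[of 3]] m by simp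
    next
      case 4 then show ?thesis using has_oa_mult[OF has_oa_4_4 less.IH[of m]] m by simp
    qed
  qed
qed

section \<open>From arrays to Latin squares\<close>

text \<open>By the pigeonhole principle, an injective line with \<open>n\<close> entries in
  \<open>{1..n}\<close> takes each symbol exactly once.\<close>

lemma latin_square_iff_inj:
  "latin_square n A \<longleftrightarrow> A \<in> carrier_mat n n \<and> (\<forall>i<n. \<forall>j<n. A $$ (i, j) \<in> {1..n}) \<and>
     (\<forall>i<n. inj_on (\<lambda>j. A $$ (i, j)) {..<n}) \<and> (\<forall>j<n. inj_on (\<lambda>i. A $$ (i, j)) {..<n})"
proof -
  have *: "(\<forall>s\<in>{1..n}. \<exists>!j. j < n \<and> f j = s) \<longleftrightarrow> inj_on f {..<n}"
    if "\<forall>j<n. f j \<in> {1..n}" for f :: "nat \<Rightarrow> nat"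
  proof
    assume "\<forall>s\<in>{1..n}. \<exists>!j. j < n \<and> f j = s"
    then show "inj_on f {..<n}" using that by (intro inj_onI) (metis lessThan_iff)
  next
    assume inj: "inj_on f {..<n}"
    have "f ` {..<n} = {1..n}"
      by (rule card_subset_eq) (use that card_image[OF inj] in auto)
    show "\<forall>s\<in>{1..n}. \<exists>!j. j < n \<and> f j = s"
    proof
      fix s assume "s \<in> {1..n}"
      then obtain j where "j < n" "f j = s" using \<open>f ` {..<n} = {1..n}\<close> by (metis imageE lessThan_iff)
      then show "\<exists>!j. j < n \<and> f j = s" using inj by (auto simp: inj_on_def)
    qed
  qed
  have rows: "(\<forall>s\<in>{1..n}. \<exists>!j. j < n \<and> A $$ (i, j) = s) \<longleftrightarrow> inj_on (\<lambda>j. A $$ (i, j)) {..<n}"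
    and cols: "(\<forall>s\<in>{1..n}. \<exists>!j. j < n \<and> A $$ (j, i) = s) \<longleftrightarrow> inj_on (\<lambda>j. A $$ (j, i)) {..<n}"
    if "\<forall>i<n. \<forall>j<n. A $$ (i, j) \<in> {1..n}" "i < n" for i
    by (rule *, use that in blast)+
  show ?thesis
  proof (cases "\<forall>i<n. \<forall>j<n. A $$ (i, j) \<in> {1..n}")
    case True
    show ?thesis unfolding latin_square_def
      by (intro conj_cong refl all_cong1 imp_cong rows[OF True] cols[OF True])
  qed (auto simp: latin_square_def)
qed

text \<open>Columns 0 and 1 of the array index the cells, columns 2 and 3 hold the symbols of the
  two squares; \<open>Suc\<close> moves the symbols to \<open>{1..n}\<close>.\<close>

lemma has_oa_4_imp_orthogonal:
  assumes "has_oa 4 n"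
  obtains A B where "orthogonal_latin_squares n A B"
proof -
  obtain Q where Q: "orthogonal_array 4 {..<n} Q" using assms by (auto simp: has_oa_def)
  have "\<exists>q. q \<in> Q \<and> q 0 = i \<and> q 1 = j" if "i < n" "j < n" for i j
    using oa_obtain[OF Q, of 0 1 i j] that by auto
  then obtain q where q: "\<And>i j. i < n \<Longrightarrow> j < n \<Longrightarrow> q i j \<in> Q \<and> q i j 0 = i \<and> q i j 1 = j"
    by metis
  let ?M = "\<lambda>c. mat n n (\<lambda>(i, j). Suc (q i j c))"
  have latin: "latin_square n (?M c)" if c: "c \<in> {2, 3}" for c
    unfolding latin_square_iff_inj
  proof (intro conjI allI impI inj_onI)
    fix i j assume "i < n" "j < n"
    then show "?M c $$ (i, j) \<in> {1..n}" using oa_mem[OF Q, of "q i j" c] q c by auto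
  next
    fix i j j' assume *: "i < n" "j \<in> {..<n}" "j' \<in> {..<n}" "?M c $$ (i, j) = ?M c $$ (i, j')"
    then have "q i j = q i j'" using c q[of i j] q[of i j'] by (intro oa_eqI[OF Q, of 0 c]) auto
    moreover have "q i j 1 = j" "q i j' 1 = j'" using q * by auto
    ultimately show "j = j'" by metis
  next
    fix j i i' assume *: "j < n" "i \<in> {..<n}" "i' \<in> {..<n}" "?M c $$ (i, j) = ?M c $$ (i', j)"
    then have "q i j = q i' j" using c q[of i j] q[of i' j] by (intro oa_eqI[OF Q, of 1 c]) auto
    moreover have "q i j 0 = i" "q i' j 0 = i'" using q * by auto
    ultimately show "i = i'" by metis
  qed simp
  have "inj_on (\<lambda>(i, j). (?M 2 $$ (i, j), ?M 3 $$ (i, j))) ({..<n} \<times> {..<n})"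
  proof (rule inj_onI, clarify)
    fix i j i' j' assume *: "i < n" "j < n" "i' < n" "j' < n"
      "?M 2 $$ (i, j) = ?M 2 $$ (i', j')" "?M 3 $$ (i, j) = ?M 3 $$ (i', j')"
    then have "q i j = q i' j'" using q[of i j] q[of i' j'] by (intro oa_eqI[OF Q, of 2 3]) auto
    then show "i = i' \<and> j = j'" using q * by metis
  qed
  then show ?thesis using that latin unfolding orthogonal_latin_squares_def by blast
qed

section \<open>Choi type squares\<close>

lemma choi_type_carrier: "A \<in> carrier_mat n n \<Longrightarrow> choi_type A \<in> carrier_mat (n\<^sup>2) (n\<^sup>2)"
  by (simp add: choi_type_def subst_kronecker_def power2_eq_square)

lemma choi_type_index:
  assumes "A \<in> carrier_mat n n" "r < n\<^sup>2" "c < n\<^sup>2"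
  shows "choi_type A $$ (r, c) = n * (A $$ (r div n, c div n) - 1) + A $$ (r mod n, c mod n)"
proof -
  have "r mod n < n" "c mod n < n" using assms by (auto intro!: mod_less_divisor Nat.gr0I)
  then show ?thesis
    using assms by (simp add: choi_type_def subst_kronecker_def all_ones_mat_def power2_eq_square)
qed

lemma div_mod_less_square:
  fixes r :: nat
  assumes "r < n\<^sup>2"
  shows "r div n < n" "r mod n < n"
  using assms by (auto simp: power2_eq_square less_mult_imp_div_less intro!: mod_less_divisor Nat.gr0I)

text \<open>Uniqueness of division with remainder, after lowering \<open>b\<close> by 1 to make it a
  remainder below \<open>n\<close>.\<close>

lemma mult_add_eq_iff:
  fixes a b a' b' n :: nat
  assumes "a \<in> {1..n}" "b \<in> {1..n}" "a' \<in> {1..n}" "b' \<in> {1..n}"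
  shows "n * (a - 1) + b = n * (a' - 1) + b' \<longleftrightarrow> a = a' \<and> b = b'"
proof
  assume eq: "n * (a - 1) + b = n * (a' - 1) + b'"
  have b: "b - 1 < n" "b' - 1 < n" using assms by auto
  have "(n * (a - 1) + (b - 1)) div n = a - 1" "(n * (a' - 1) + (b' - 1)) div n = a' - 1"
    using b by (simp_all add: div_mult_self4)
  moreover have "n * (a - 1) + (b - 1) = n * (a' - 1) + (b' - 1)" using eq assms by auto
  ultimately have "a - 1 = a' - 1" by metis
  then show "a = a' \<and> b = b'" using assms eq by auto
qed simp

text \<open>Comparing symbols decouples into a comparison between blocks and one within them, so
  each property of \<open>A\<close> is applied once to quotients and once to remainders of the
  indices.\<close>

lemma choi_type_eq_iff:
  assumes A: "latin_square n A" and "r < n\<^sup>2" "c < n\<^sup>2" "r' < n\<^sup>2" "c' < n\<^sup>2"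
  shows "choi_type A $$ (r, c) = choi_type A $$ (r', c') \<longleftrightarrow>
    A $$ (r div n, c div n) = A $$ (r' div n, c' div n) \<and>
    A $$ (r mod n, c mod n) = A $$ (r' mod n, c' mod n)"
proof -
  have "A \<in> carrier_mat n n" "\<And>i j. i < n \<Longrightarrow> j < n \<Longrightarrow> A $$ (i, j) \<in> {1..n}"
    using A by (auto simp: latin_square_def)
  then show ?thesis
    using assms(2-) by (simp only: choi_type_index mult_add_eq_iff div_mod_less_square)
qed

lemma eq_if_div_mod_eq: "r div n = r' div n \<Longrightarrow> r mod n = r' mod n \<Longrightarrow> r = (r' :: nat)"
  by (metis div_mult_mod_eq)

lemma latin_square_choi_type:
  assumes A: "latin_square n A"
  shows "latin_square (n\<^sup>2) (choi_type A)"
proof -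
  have carrier: "A \<in> carrier_mat n n" and mem: "\<And>i j. i < n \<Longrightarrow> j < n \<Longrightarrow> A $$ (i, j) \<in> {1..n}"
    and row: "\<And>i j j'. i < n \<Longrightarrow> j < n \<Longrightarrow> j' < n \<Longrightarrow> A $$ (i, j) = A $$ (i, j') \<Longrightarrow> j = j'"
    and col: "\<And>j i i'. j < n \<Longrightarrow> i < n \<Longrightarrow> i' < n \<Longrightarrow> A $$ (i, j) = A $$ (i', j) \<Longrightarrow> i = i'"
    using A by (auto simp: latin_square_iff_inj inj_on_def)
  show ?thesis unfolding latin_square_iff_inj
  proof (intro conjI allI impI inj_onI)
    fix r c assume rc: "r < n\<^sup>2" "c < n\<^sup>2"
    let ?a = "A $$ (r div n, c div n)" and ?b = "A $$ (r mod n, c mod n)"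
    have ab: "?a \<in> {1..n}" "?b \<in> {1..n}" by (simp_all only: mem div_mod_less_square rc)
    \<comment> \<open>Since \<open>?b \<le> n\<close>, the symbol is at most \<open>n * ?a\<close>,
      hence at most the square of \<open>n\<close>.\<close>
    then have "n * (?a - 1) + n = n * ?a" by (cases ?a) auto
    also have "\<dots> \<le> n\<^sup>2" using ab by (simp add: power2_eq_square)
    finally have "n * (?a - 1) + n \<le> n\<^sup>2" .
    then show "choi_type A $$ (r, c) \<in> {1..n\<^sup>2}"
      using ab by (simp add: choi_type_index[OF carrier rc])
  next
    fix r c c' assume *: "r < n\<^sup>2" "c \<in> {..<n\<^sup>2}" "c' \<in> {..<n\<^sup>2}"
      "choi_type A $$ (r, c) = choi_type A $$ (r, c')"
    have "c div n = c' div n"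
      by (rule row[of "r div n"]) (use * in \<open>simp_all add: choi_type_eq_iff[OF A] div_mod_less_square\<close>)
    moreover have "c mod n = c' mod n"
      by (rule row[of "r mod n"]) (use * in \<open>simp_all add: choi_type_eq_iff[OF A] div_mod_less_square\<close>)
    ultimately show "c = c'" by (rule eq_if_div_mod_eq)
  next
    fix c r r' assume *: "c < n\<^sup>2" "r \<in> {..<n\<^sup>2}" "r' \<in> {..<n\<^sup>2}"
      "choi_type A $$ (r, c) = choi_type A $$ (r', c)"
    have "r div n = r' div n"
      by (rule col[of "c div n"]) (use * in \<open>simp_all add: choi_type_eq_iff[OF A] div_mod_less_square\<close>)
    moreover have "r mod n = r' mod n"
      by (rule col[of "c mod n"]) (use * in \<open>simp_all add: choi_type_eq_iff[OF A] div_mod_less_square\<close>)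
    ultimately show "r = r'" by (rule eq_if_div_mod_eq)
  qed (rule choi_type_carrier[OF carrier])
qed

lemma orthogonal_choi_type:
  assumes "orthogonal_latin_squares n A B"
  shows "orthogonal_latin_squares (n\<^sup>2) (choi_type A) (choi_type B)"
proof -
  have A: "latin_square n A" and B: "latin_square n B"
    and inj: "\<And>i j i' j'. i < n \<Longrightarrow> j < n \<Longrightarrow> i' < n \<Longrightarrow> j' < n \<Longrightarrow>
      A $$ (i, j) = A $$ (i', j') \<Longrightarrow> B $$ (i, j) = B $$ (i', j') \<Longrightarrow> i = i' \<and> j = j'"
    using assms by (auto simp: orthogonal_latin_squares_def inj_on_def)
  have "inj_on (\<lambda>(r, c). (choi_type A $$ (r, c), choi_type B $$ (r, c))) ({..<n\<^sup>2} \<times> {..<n\<^sup>2})"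
  proof (rule inj_onI, clarify)
    fix r c r' c' assume lt: "r < n\<^sup>2" "c < n\<^sup>2" "r' < n\<^sup>2" "c' < n\<^sup>2"
      and eq: "choi_type A $$ (r, c) = choi_type A $$ (r', c')"
        "choi_type B $$ (r, c) = choi_type B $$ (r', c')"
    note eq' = eq[unfolded choi_type_eq_iff[OF A lt] choi_type_eq_iff[OF B lt]]
    have "r div n = r' div n \<and> c div n = c' div n"
      using eq' by (intro inj div_mod_less_square lt) simp_all
    moreover have "r mod n = r' mod n \<and> c mod n = c' mod n"
      using eq' by (intro inj div_mod_less_square lt) simp_all
    ultimately show "r = r' \<and> c = c'" using eq_if_div_mod_eq by blast
  qed
  then show ?thesis
    using A B by (simp add: orthogonal_latin_squares_def latin_square_choi_type)
qed

theorem corollary2p4: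
  fixes n :: nat
  assumes "n \<ge> 3" and "n \<noteq> 6"
  shows "\<exists>A B. latin_square n A \<and> latin_square n B \<and>
           orthogonal_latin_squares (n ^ 2) (choi_type A) (choi_type B)"
proof -
  obtain A B where "orthogonal_latin_squares n A B"
    using has_oa_4_imp_orthogonal[OF has_oa_4[OF assms]] .
  then show ?thesis
    using orthogonal_choi_type[of n A B] unfolding orthogonal_latin_squares_def[of n] by blast
qed

end
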